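(* Let $k\ge 1$. For all $t\in\mathbb{R}$ and $f\in C^\infty(\mathbb{R})$, the map $J_{f,t}:J^k(\mathbb{R})\to\mathrm{im}(j^k(f))$ is locally Lipschitz (with respect to $d_{cc}$ on both sides).
   Context: Let $k\ge 1$ be an integer. The jet space Carnot group $J^k(\mathbb{R})$ is the set $\mathbb{R}^{k+2}$, with points written $(x,u_k,\ldots,u_0)$, equipped with the group operation $(x,u_k,\ldots,u_0)\odot(y,v_k,\ldots,v_0)=(x+y,w_k,\ldots,w_0)$, where $w_k=u_k+v_k$ and $w_s=u_s+v_s+\sum_{j=s+1}^k u_j\frac{y^{j-s}}{(j-s)!}$ for $s=0,\ldots,k-1$. The horizontal bundle is framed by the left-invariant vector fields $X^{(k)}=\frac{\partial}{\partial x}+u_k\frac{\partial}{\partial u_{k-1}}+\cdots+u_1\frac{\partial}{\partial u_0}$ and $\frac{\partial}{\partial u_k}$, declared orthonormal; a horizontal curve is a curve that is absolutely continuous into $\mathbb{R}^{k+2}$ and whose derivative lies a.e. in the horizontal bundle. The Carnot–Carathéodory distance $d_{cc}(p,q)$ is the infimum of lengths of horizontal curves connecting $p$ to $q$. For $f\in C^\infty(\mathbb{R})$ and $x\in\mathbb{R}$, $j^k_x(f):=j^k(f)(x):=(x,f^{(k)}(x),f^{(k-1)}(x),\ldots,f(x))\in J^k(\mathbb{R})$, and $\mathrm{im}(j^k(f)):=\{j^k_x(f):x\in\mathbb{R}\}$. For $f\in C^\infty(\mathbb{R})$ and $t\in\mathbb{R}$, the horizontal mapping is $J_{f,t}:J^k(\mathbb{R})\to\mathrm{im}(j^k(f))$,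 $J_{f,t}(x,u_k,\ldots,u_0):=j^k_{x-t}(f)$. "Locally Lipschitz" means that the restriction to each compact set is Lipschitz. *)

theory Defs
  imports "HOL-Analysis.Analysis"
begin

text \<open>
  A point \<open>(x, u\<^sub>k, \<dots>, u\<^sub>0)\<close> of \<open>J\<^sup>k(\<real>) = \<real>\<^sup>k\<^sup>+\<^sup>2\<close> is encoded as the pair \<open>(x, u)\<close> with
  \<open>u j = u\<^sub>j\<close> for \<open>j \<le> k\<close> and \<open>u j = 0\<close> for \<open>j > k\<close>. On \<open>jet_space k\<close> the product topology of
  \<open>real \<times> (nat \<Rightarrow> real)\<close> is the Euclidean topology of \<open>\<real>\<^sup>k\<^sup>+\<^sup>2\<close>, so \<open>compact\<close> has its usual meaning.
  Tangent vectors are encoded in the same way.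
\<close>

type_synonym jet_point = "real \<times> (nat \<Rightarrow> real)"

definition jet_space :: "nat \<Rightarrow> jet_point set" where
  "jet_space k = {p. \<forall>j>k. snd p j = 0}"

definition jet_euclid_dist :: "nat \<Rightarrow> jet_point \<Rightarrow> jet_point \<Rightarrow> real" where
  "jet_euclid_dist k p q = sqrt ((fst p - fst q)\<^sup>2 + (\<Sum>j\<le>k. (snd p j - snd q j)\<^sup>2))"

definition jet_lincomb :: "real \<Rightarrow> jet_point \<Rightarrow> real \<Rightarrow> jet_point \<Rightarrow> jet_point" where
  "jet_lincomb \<alpha> v \<beta> w = (\<alpha> * fst v + \<beta> * fst w, \<lambda>j. \<alpha> * snd v j + \<beta> * snd w j)"

text \<open>
  The frame \<open>X\<^sup>(\<^sup>k\<^sup>) = \<partial>/\<partial>x + u\<^sub>k \<partial>/\<partial>u\<^sub>k\<^sub>-\<^sub>1 + \<dots> + u\<^sub>1 \<partial>/\<partial>u\<^sub>0\<close> and \<open>\<partial>/\<partial>u\<^sub>k\<close>.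
\<close>

definition field_X :: "nat \<Rightarrow> jet_point \<Rightarrow> jet_point" where
  "field_X k p = (1, \<lambda>j. if j < k then snd p (Suc j) else 0)"

definition field_U :: "nat \<Rightarrow> jet_point \<Rightarrow> jet_point" where
  "field_U k p = (0, \<lambda>j. if j = k then 1 else 0)"

definition horizontal_space :: "nat \<Rightarrow> jet_point \<Rightarrow> jet_point set" where
  "horizontal_space k p = {jet_lincomb \<alpha> (field_X k p) \<beta> (field_U k p) | \<alpha> \<beta>. True}"

text \<open>
  The norm on horizontal vectors for which the frame is orthonormal. The two frame coefficients of
  a horizontal vector are its \<open>x\<close>-component and its \<open>u\<^sub>k\<close>-component, independently of the base point.
\<close>

definition horizontal_norm :: "nat \<Rightarrow> jet_point \<Rightarrow> real" where
  "horizontal_norm k v = sqrt ((fst v)\<^sup>2 + (snd v k)\<^sup>2)"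

lemma horizontal_norm_frame:
  "horizontal_norm k (jet_lincomb \<alpha> (field_X k p) \<beta> (field_U k p)) = sqrt (\<alpha>\<^sup>2 + \<beta>\<^sup>2)"
  by (simp add: horizontal_norm_def jet_lincomb_def field_X_def field_U_def)

definition jet_has_derivative :: "(real \<Rightarrow> jet_point) \<Rightarrow> jet_point \<Rightarrow> real \<Rightarrow> bool" where
  "jet_has_derivative \<gamma> v s \<longleftrightarrow>
     ((\<lambda>r. fst (\<gamma> r)) has_real_derivative fst v) (at s) \<and>
     (\<forall>j. ((\<lambda>r. snd (\<gamma> r) j) has_real_derivative snd v j) (at s))"

definition jet_deriv :: "(real \<Rightarrow> jet_point) \<Rightarrow> real \<Rightarrow> jet_point" where
  "jet_deriv \<gamma> s = (deriv (\<lambda>r. fst (\<gamma> r)) s, \<lambda>j. deriv (\<lambda>r. snd (\<gamma> r) j) s)"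

text \<open>
  \<open>D\<close> is a finite family of subintervals \<open>[c, d]\<close> of \<open>[a, b]\<close> with pairwise disjoint interiors.
\<close>

definition absolutely_continuous_curve ::
    "nat \<Rightarrow> real \<Rightarrow> real \<Rightarrow> (real \<Rightarrow> jet_point) \<Rightarrow> bool" where
  "absolutely_continuous_curve k a b \<gamma> \<longleftrightarrow>
     (\<forall>\<epsilon>>0. \<exists>\<delta>>0. \<forall>D.
        finite D \<and> (\<forall>(c, d)\<in>D. a \<le> c \<and> c \<le> d \<and> d \<le> b) \<and>
        disjoint_family_on (\<lambda>(c, d). {c<..<d}) D \<and> (\<Sum>(c, d)\<in>D. d - c) < \<delta>
        \<longrightarrow> (\<Sum>(c, d)\<in>D. jet_euclid_dist k (\<gamma> c) (\<gamma> d)) < \<epsilon>)"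

definition horizontal_curve :: "nat \<Rightarrow> real \<Rightarrow> real \<Rightarrow> (real \<Rightarrow> jet_point) \<Rightarrow> bool" where
  "horizontal_curve k a b \<gamma> \<longleftrightarrow>
     (\<forall>s\<in>{a..b}. \<gamma> s \<in> jet_space k) \<and>
     absolutely_continuous_curve k a b \<gamma> \<and>
     (AE s\<in>{a<..<b} in lebesgue. \<exists>v\<in>horizontal_space k (\<gamma> s). jet_has_derivative \<gamma> v s)"

definition curve_length :: "nat \<Rightarrow> real \<Rightarrow> real \<Rightarrow> (real \<Rightarrow> jet_point) \<Rightarrow> ennreal" where
  "curve_length k a b \<gamma> = (\<integral>\<^sup>+s\<in>{a..b}. ennreal (horizontal_norm k (jet_deriv \<gamma> s)) \<partial>lebesgue)"

text \<open>
  The infimum is taken in \<open>[0, \<infinity>]\<close>, so that it needs no prior proof that any two points are joined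
  by a horizontal curve (of finite length).
\<close>

definition cc_dist :: "nat \<Rightarrow> jet_point \<Rightarrow> jet_point \<Rightarrow> ennreal" where
  "cc_dist k p q =
     Inf {curve_length k a b \<gamma> | a b \<gamma>.
            a \<le> b \<and> horizontal_curve k a b \<gamma> \<and> \<gamma> a = p \<and> \<gamma> b = q}"

definition smooth :: "(real \<Rightarrow> real) \<Rightarrow> bool" where
  "smooth f \<longleftrightarrow> (\<forall>n. (deriv ^^ n) f differentiable_on UNIV)"

definition jet :: "nat \<Rightarrow> (real \<Rightarrow> real) \<Rightarrow> real \<Rightarrow> jet_point" where
  "jet k f x = (x, \<lambda>j. if j \<le> k then (deriv ^^ j) f x else 0)"

definition jet_image :: "nat \<Rightarrow> (real \<Rightarrow> real) \<Rightarrow> jet_point set" where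
  "jet_image k f = range (jet k f)"

definition horizontal_map :: "nat \<Rightarrow> (real \<Rightarrow> real) \<Rightarrow> real \<Rightarrow> jet_point \<Rightarrow> jet_point" where
  "horizontal_map k f t p = jet k f (fst p - t)"

definition cc_lipschitz_on :: "nat \<Rightarrow> jet_point set \<Rightarrow> (jet_point \<Rightarrow> jet_point) \<Rightarrow> bool" where
  "cc_lipschitz_on k K F \<longleftrightarrow>
     (\<exists>L\<ge>0. \<forall>p\<in>K. \<forall>q\<in>K. cc_dist k (F p) (F q) \<le> ennreal L * cc_dist k p q)"

text \<open>Both \<open>A\<close> and \<open>B\<close> carry the restriction of the distance of the ambient jet space.\<close>

definition cc_locally_lipschitz ::
    "nat \<Rightarrow> jet_point set \<Rightarrow> jet_point set \<Rightarrow> (jet_point \<Rightarrow> jet_point) \<Rightarrow> bool" where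
  "cc_locally_lipschitz k A B F \<longleftrightarrow>
     F \<in> A \<rightarrow> B \<and> (\<forall>K. compact K \<and> K \<subseteq> A \<longrightarrow> cc_lipschitz_on k K F)"

end

theory Submission
  imports Defs
begin

text \<open>
  A horizontal mapping sees only the first coordinate \<open>x\<close> of a point, so the theorem follows by
  factoring it as \<open>p \<mapsto> fst p \<mapsto> j\<^sup>k\<^bsub>x-t\<^esub>(f)\<close> and estimating the two factors separately.

  The projection \<open>fst\<close> does not increase distances (\<open>fst_le_cc_dist\<close>): along a horizontal curve the
  speed \<open>\<bar>x'\<bar>\<close> is one of the two frame coefficients, hence at most the horizontal norm, and the
  increment of \<open>x\<close> is at most the integral of \<open>\<bar>x'\<bar>\<close>. The last step is the fundamental theorem of
  calculus for absolutely continuous functions, \<open>abs_continuous_has_integral\<close>. Since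
  differentiability almost everywhere is part of being horizontal, it need not be derived from
  absolute continuity, and a direct argument with gauges gives the theorem.

  The map \<open>x \<mapsto> j\<^sup>k\<^sub>x(f)\<close> is Lipschitz on bounded intervals (\<open>cc_dist_jet_le\<close>): the jet of \<open>f\<close> is itself
  a horizontal curve with velocity \<open>X\<^sup>(\<^sup>k\<^sup>) + f\<^sup>(\<^sup>k\<^sup>+\<^sup>1\<^sup>) \<partial>/\<partial>u\<^sub>k\<close>, so the arc over \<open>[u, v]\<close> has length at
  most \<open>sqrt (1 + B\<^sup>2) \<cdot> \<bar>u - v\<bar>\<close> if \<open>B\<close> bounds \<open>\<bar>f\<^sup>(\<^sup>k\<^sup>+\<^sup>1\<^sup>)\<bar>\<close> there. A compact set of jets has bounded first
  coordinates, and \<open>B\<close> is found by continuity.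
\<close>

section \<open>Absolutely continuous functions and their derivatives\<close>

definition abs_continuous :: "real \<Rightarrow> real \<Rightarrow> (real \<Rightarrow> 'a::real_normed_vector) \<Rightarrow> bool" where
  "abs_continuous a b g \<longleftrightarrow>
     (\<forall>\<epsilon>>0. \<exists>\<delta>>0. \<forall>D.
        finite D \<and> (\<forall>(c, d)\<in>D. a \<le> c \<and> c \<le> d \<and> d \<le> b) \<and>
        disjoint_family_on (\<lambda>(c, d). {c<..<d}) D \<and> (\<Sum>(c, d)\<in>D. d - c) < \<delta>
        \<longrightarrow> (\<Sum>(c, d)\<in>D. norm (g d - g c)) < \<epsilon>)"

text \<open>
  This makes an open set of small measure usable in the definition of absolute continuity: every
  finite family of nonoverlapping intervals inside it has small total length.
\<close>

lemma sum_lengths_le_measure: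
  fixes D :: "(real \<times> real) set"
  assumes "finite D" and le: "\<And>c d. (c, d) \<in> D \<Longrightarrow> c \<le> d"
    and dis: "disjoint_family_on (\<lambda>(c, d). {c<..<d}) D"
    and sub: "\<And>c d. (c, d) \<in> D \<Longrightarrow> {c<..<d} \<subseteq> U"
    and U: "U \<in> lmeasurable"
  shows "(\<Sum>(c, d)\<in>D. d - c) \<le> measure lebesgue U"
proof -
  let ?I = "\<lambda>(c, d). {c<..<d::real}"
  have "(\<Sum>(c, d)\<in>D. d - c) = (\<Sum>p\<in>D. measure lebesgue (?I p))"
    using le by (intro sum.cong) auto
  also have "\<dots> = measure lebesgue (\<Union>p\<in>D. ?I p)"
    using \<open>finite D\<close> dis by (intro measure_finite_Union [symmetric]) (auto split: prod.splits dest!: le)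
  also have "\<dots> \<le> measure lebesgue U"
    using sub U by (intro measure_mono_fmeasurable) (auto intro!: sets.finite_UN assms(1))
  finally show ?thesis .
qed

text \<open>
  The straddle lemma: differentiability at \<open>x\<close> controls increments over all short intervals
  containing \<open>x\<close>, because the errors at the two endpoints are proportional to distances from \<open>x\<close>
  that add up to the length of the interval.
\<close>

lemma has_vector_derivative_straddle:
  fixes g :: "real \<Rightarrow> 'a::real_normed_vector"
  assumes "(g has_vector_derivative g') (at x within {a..b})" "e > 0"
  obtains r where "r > 0"
    "\<And>u v. \<lbrakk>u \<in> {a..b}; v \<in> {a..b}; u \<le> x; x \<le> v; \<bar>u - x\<bar> < r; \<bar>v - x\<bar> < r\<rbrakk>
      \<Longrightarrow> norm ((v - u) *\<^sub>R g' - (g v - g u)) \<le> e * (v - u)"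
proof -
  obtain r where "r > 0" and r: "\<And>y. \<lbrakk>y \<in> {a..b}; \<bar>y - x\<bar> < r\<rbrakk>
      \<Longrightarrow> norm (g y - g x - (y - x) *\<^sub>R g') \<le> e * \<bar>y - x\<bar>"
    using assms unfolding has_vector_derivative_def has_derivative_within_alt by (metis real_norm_def)
  show thesis
  proof (rule that[OF \<open>r > 0\<close>])
    fix u v assume uv: "u \<in> {a..b}" "v \<in> {a..b}" "u \<le> x" "x \<le> v" "\<bar>u - x\<bar> < r" "\<bar>v - x\<bar> < r"
    have "(v - u) *\<^sub>R g' - (g v - g u)
        = (g u - g x - (u - x) *\<^sub>R g') - (g v - g x - (v - x) *\<^sub>R g')"
      by (simp add: algebra_simps)
    then have "norm ((v - u) *\<^sub>R g' - (g v - g u))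
        \<le> norm (g u - g x - (u - x) *\<^sub>R g') + norm (g v - g x - (v - x) *\<^sub>R g')"
      by (metis norm_triangle_ineq4)
    also have "\<dots> \<le> e * \<bar>u - x\<bar> + e * \<bar>v - x\<bar>"
      by (intro add_mono r uv)
    also have "\<dots> = e * (v - u)"
      using uv by (simp add: algebra_simps)
    finally show "norm ((v - u) *\<^sub>R g' - (g v - g u)) \<le> e * (v - u)" .
  qed
qed

text \<open>
  The gauge is chosen differently off and on the null set \<open>N\<close>. Off \<open>N\<close> the straddle lemma makes the
  Riemann sum agree with the increment of \<open>g\<close> up to a small multiple of the length. On \<open>N\<close>, where
  the integrand may be set to \<open>0\<close>, the gauge keeps the intervals inside an open \<open>U \<supseteq> N\<close> of small
  measure, so that the increments of \<open>g\<close> over them are small in total by absolute continuity.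
  Integrability of \<open>g'\<close> comes out as part of the conclusion.
\<close>

lemma abs_continuous_has_integral:
  fixes g :: "real \<Rightarrow> 'a::banach"
  assumes "a \<le> b" and ac: "abs_continuous a b g" and N: "negligible N"
    and deriv: "\<And>x. x \<in> {a..b} - N \<Longrightarrow> (g has_vector_derivative g' x) (at x within {a..b})"
  shows "(g' has_integral (g b - g a)) {a..b}"
proof -
  define h where "h x = (if x \<in> N then 0 else g' x)" for x
  have "(h has_integral (g b - g a)) (cbox a b)"
    unfolding has_integral
  proof (intro allI impI)
    fix e :: real assume "e > 0"
    \<comment> \<open>The summand 1 keeps the denominator positive when \<open>a = b\<close>.\<close>
    define \<eta> where "\<eta> = e / (2 * (b - a + 1))"
    have "\<eta> > 0" and \<eta>: "\<eta> * (b - a) \<le> e / 2"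
    proof -
      show "\<eta> > 0" using \<open>e > 0\<close> \<open>a \<le> b\<close> by (simp add: \<eta>_def)
      have "\<eta> * (b - a) \<le> \<eta> * (b - a + 1)" using \<open>\<eta> > 0\<close> by simp
      also have "\<dots> = e / 2" using \<open>a \<le> b\<close> by (auto simp: \<eta>_def divide_simps)
      finally show "\<eta> * (b - a) \<le> e / 2" .
    qed
    obtain \<delta> where "\<delta> > 0" and \<delta>: "\<And>D. \<lbrakk>finite D; \<forall>(c, d)\<in>D. a \<le> c \<and> c \<le> d \<and> d \<le> b;
        disjoint_family_on (\<lambda>(c, d). {c<..<d}) D; (\<Sum>(c, d)\<in>D. d - c) < \<delta>\<rbrakk>
        \<Longrightarrow> (\<Sum>(c, d)\<in>D. norm (g d - g c)) < e / 2"
      using ac[unfolded abs_continuous_def, rule_format, OF half_gt_zero[OF \<open>e > 0\<close>]] by blast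
    have Nl: "N \<in> sets lebesgue" and N0: "measure lebesgue N = 0"
      using N by (auto simp: negligible_iff_measure fmeasurableD)
    obtain U where U: "open U" "N \<subseteq> U" "U - N \<in> lmeasurable" "emeasure lebesgue (U - N) < ennreal \<delta>"
      using sets_lebesgue_outer_open[OF Nl \<open>\<delta> > 0\<close>] by metis
    have Ueq: "U = (U - N) \<union> N" using U by auto
    have Ul: "U \<in> lmeasurable"
      using N U(3) Ueq by (metis fmeasurable.Un negligible_iff_measure)
    have "measure lebesgue U \<le> measure lebesgue (U - N) + measure lebesgue N"
      using measure_Un_le[of "U - N" lebesgue N] U(3) Nl Ueq by (metis fmeasurableD)
    then have Um: "measure lebesgue U < \<delta>"
      using U(3,4) N0 \<open>\<delta> > 0\<close> by (simp add: emeasure_eq_measure2 fmeasurableD2 ennreal_less_iff)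
    have "\<exists>r>0. (x \<in> N \<longrightarrow> ball x r \<subseteq> U) \<and> (x \<in> {a..b} - N \<longrightarrow>
        (\<forall>u v. u \<in> {a..b} \<longrightarrow> v \<in> {a..b} \<longrightarrow> u \<le> x \<longrightarrow> x \<le> v \<longrightarrow> \<bar>u - x\<bar> < r \<longrightarrow> \<bar>v - x\<bar> < r
          \<longrightarrow> norm ((v - u) *\<^sub>R g' x - (g v - g u)) \<le> \<eta> * (v - u)))" for x
    proof (cases "x \<in> N")
      case True
      then show ?thesis using U by (metis DiffD2 open_contains_ball subsetD)
    next
      case False
      show ?thesis
      proof (cases "x \<in> {a..b}")
        case True
        with False have "x \<in> {a..b} - N" by simp
        from has_vector_derivative_straddle[OF deriv[OF this] \<open>\<eta> > 0\<close>]
        obtain r where "r > 0" "\<And>u v. \<lbrakk>u \<in> {a..b}; v \<in> {a..b}; u \<le> x; x \<le> v; \<bar>u - x\<bar> < r; \<bar>v - x\<bar> < r\<rbrakk>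
          \<Longrightarrow> norm ((v - u) *\<^sub>R g' x - (g v - g u)) \<le> \<eta> * (v - u)" by blast
        with False show ?thesis by blast
      next
        case nab: False
        with False show ?thesis by (intro exI[of _ 1]) auto
      qed
    qed
    then obtain r where r: "\<And>x. r x > 0" "\<And>x. x \<in> N \<Longrightarrow> ball x (r x) \<subseteq> U"
      "\<And>x u v. \<lbrakk>x \<in> {a..b} - N; u \<in> {a..b}; v \<in> {a..b}; u \<le> x; x \<le> v; \<bar>u - x\<bar> < r x; \<bar>v - x\<bar> < r x\<rbrakk>
          \<Longrightarrow> norm ((v - u) *\<^sub>R g' x - (g v - g u)) \<le> \<eta> * (v - u)"
      by metis
    show "\<exists>\<gamma>. gauge \<gamma> \<and> (\<forall>D. D tagged_division_of cbox a b \<and> \<gamma> fine D \<longrightarrow>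
           norm ((\<Sum>(x, K)\<in>D. measure lborel K *\<^sub>R h x) - (g b - g a)) < e)"
    proof (intro exI conjI allI impI; (elim conjE)?)
      show "gauge (\<lambda>x. ball x (r x))"
        using r(1) gauge_ball_dependent by blast
      fix p assume p: "p tagged_division_of cbox a b" and fine: "(\<lambda>x. ball x (r x)) fine p"
      note pD = tagged_division_ofD[OF p]
      have K: "K = {Inf K..Sup K} \<and> Inf K \<le> x \<and> x \<le> Sup K \<and> Inf K \<in> {a..b} \<and> Sup K \<in> {a..b}
          \<and> {Inf K..Sup K} \<subseteq> ball x (r x)" if "(x, K) \<in> p" for x K
      proof -
        obtain u v where uv: "K = cbox u v" using pD(4)[OF \<open>(x, K) \<in> p\<close>] by blast
        have "x \<in> K" "K \<subseteq> cbox a b" "K \<subseteq> ball x (r x)"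
          using pD(2,3)[OF \<open>(x, K) \<in> p\<close>] fineD[OF fine \<open>(x, K) \<in> p\<close>] by auto
        then show ?thesis unfolding uv by auto
      qed
      \<comment> \<open>The tagged intervals controlled by absolute continuity instead of the derivative.\<close>
      define q where "q = {z \<in> p. fst z \<in> N}"
      have "finite p" "q \<subseteq> p" "finite q" using pD(1) by (auto simp: q_def)
      have gsum: "g b - g a = (\<Sum>(x, K)\<in>p. g (Sup K) - g (Inf K))"
        and lsum: "b - a = (\<Sum>(x, K)\<in>p. Sup K - Inf K)"
        using additive_tagged_division_1[OF \<open>a \<le> b\<close>, of p g]
          additive_tagged_division_1[OF \<open>a \<le> b\<close>, of p "\<lambda>x. x"] p by auto
      define T where "T = (\<lambda>(x, K). measure lborel K *\<^sub>R h x - (g (Sup K) - g (Inf K)))"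
      have T: "(\<Sum>(x, K)\<in>p. measure lborel K *\<^sub>R h x) - (g b - g a) = sum T p"
        unfolding gsum T_def by (simp add: sum_subtractf[symmetric] case_prod_unfold)
      have good: "norm (sum T (p - q)) \<le> e / 2"
      proof -
        have "norm (sum T (p - q)) \<le> (\<Sum>(x, K)\<in>p - q. \<eta> * (Sup K - Inf K))"
        proof (rule sum_norm_le, clarify)
          fix x K assume xK: "(x, K) \<in> p" "(x, K) \<notin> q"
          then have "x \<notin> N" by (auto simp: q_def)
          moreover have "measure lborel K = Sup K - Inf K"
            using K[OF xK(1)] by (metis content_real order_trans)
          moreover have "x \<in> {a..b}" using pD(2,3)[OF xK(1)] by auto
          moreover have "Inf K \<in> ball x (r x)" "Sup K \<in> ball x (r x)"
            using K[OF xK(1)] by (meson atLeastAtMost_iff order_refl order_trans subsetD)+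
          then have "\<bar>Inf K - x\<bar> < r x" "\<bar>Sup K - x\<bar> < r x"
            by (auto simp: dist_real_def)
          ultimately show "norm (T (x, K)) \<le> \<eta> * (Sup K - Inf K)"
            using r(3)[of x "Inf K" "Sup K"] K[OF xK(1)] by (simp add: T_def h_def)
        qed
        also have "\<dots> \<le> (\<Sum>(x, K)\<in>p. \<eta> * (Sup K - Inf K))"
        proof (rule sum_mono2[OF \<open>finite p\<close>])
          fix z assume "z \<in> p - (p - q)"
          then obtain x K where z: "z = (x, K)" and "(x, K) \<in> p" by (cases z) auto
          then have "Inf K \<le> Sup K" using K by (meson order_trans)
          then show "0 \<le> (case z of (x, K) \<Rightarrow> \<eta> * (Sup K - Inf K))"
            using \<open>\<eta> > 0\<close> by (simp add: z)
        qed auto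
        also have "\<dots> = \<eta> * (b - a)"
          by (simp add: lsum sum_distrib_left case_prod_unfold)
        finally show ?thesis using \<eta> by linarith
      qed
      have bad: "norm (sum T q) < e / 2"
      proof -
        define E where "E = (\<lambda>(x::real, K). (Inf K, Sup K :: real))"
        have int: "interior K = {Inf K<..<Sup K}" if "(x, K) \<in> p" for x K
          using K[OF that] by (metis interior_atLeastAtMost_real)
        \<comment> \<open>A degenerate interval determines its tag, and a nondegenerate one occurs only once.\<close>
        have inj: "inj_on E q"
        proof (rule inj_onI, clarify)
          fix x K x' K' assume z: "(x, K) \<in> q" "(x', K') \<in> q" and "E (x, K) = E (x', K')"
          then have zp: "(x, K) \<in> p" "(x', K') \<in> p" and eq: "Inf K = Inf K'" "Sup K = Sup K'"
            using \<open>q \<subseteq> p\<close> by (auto simp: E_def)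
          then have "K = K'" using K by metis
          moreover have "x = x'"
          proof (rule ccontr)
            assume "x \<noteq> x'"
            then have "{Inf K<..<Sup K} = {}"
              using pD(5)[OF zp] int[OF zp(1)] \<open>K = K'\<close> by auto
            then have "Sup K \<le> Inf K" by simp
            with K[OF zp(1)] K[OF zp(2)] \<open>K = K'\<close> \<open>x \<noteq> x'\<close> show False by auto
          qed
          ultimately show "x = x' \<and> K = K'" by simp
        qed
        have fin: "finite (E ` q)" using \<open>finite q\<close> by simp
        have bounds: "\<forall>(c, d)\<in>E ` q. a \<le> c \<and> c \<le> d \<and> d \<le> b"
          using K \<open>q \<subseteq> p\<close> by (fastforce simp: E_def)
        have dis: "disjoint_family_on (\<lambda>(c, d). {c<..<d}) (E ` q)"
          unfolding disjoint_family_on_def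
        proof (intro ballI impI)
          fix m n assume "m \<in> E ` q" "n \<in> E ` q" "m \<noteq> n"
          then obtain x K x' K' where m: "m = E (x, K)" and n: "n = E (x', K')"
            and zq: "(x, K) \<in> q" "(x', K') \<in> q"
            by (metis imageE surj_pair)
          then have zp: "(x, K) \<in> p" "(x', K') \<in> p" and ne: "(x, K) \<noteq> (x', K')"
            using \<open>q \<subseteq> p\<close> \<open>m \<noteq> n\<close> by blast+
          have "{Inf K<..<Sup K} \<inter> {Inf K'<..<Sup K'} = {}"
            using pD(5)[OF zp ne] int[OF zp(1)] int[OF zp(2)] by (simp only:)
          then show "(case m of (c, d) \<Rightarrow> {c<..<d}) \<inter> (case n of (c, d) \<Rightarrow> {c<..<d}) = {}"
            by (simp add: m n E_def del: Int_greaterThanLessThan)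
        qed
        have sub: "{c<..<d} \<subseteq> U" if cd: "(c, d) \<in> E ` q" for c d
        proof -
          obtain x K where xK: "(x, K) \<in> q" "c = Inf K" "d = Sup K" using cd by (auto simp: E_def)
          then have "x \<in> N" "(x, K) \<in> p" by (auto simp: q_def)
          with r(2)[of x] K[of x K] xK show ?thesis
            by (meson greaterThanLessThan_subseteq_atLeastAtMost_iff order_refl subset_trans)
        qed
        have "(\<Sum>(c, d)\<in>E ` q. d - c) < \<delta>"
          using sum_lengths_le_measure[OF fin _ dis sub Ul] bounds Um by fastforce
        from \<delta>[OF fin bounds dis this]
        have "(\<Sum>(x, K)\<in>q. norm (g (Sup K) - g (Inf K))) < e / 2"
          by (simp add: sum.reindex[OF inj] o_def) (simp add: E_def case_prod_unfold)
        moreover have "norm (sum T q) \<le> (\<Sum>(x, K)\<in>q. norm (g (Sup K) - g (Inf K)))"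
          by (rule sum_norm_le) (auto simp: T_def h_def q_def norm_minus_commute)
        ultimately show ?thesis by linarith
      qed
      have "sum T p = sum T (p - q) + sum T q"
        using \<open>finite p\<close> \<open>q \<subseteq> p\<close> by (simp add: sum.subset_diff)
      then have "norm (sum T p) \<le> norm (sum T (p - q)) + norm (sum T q)"
        by (simp add: norm_triangle_ineq)
      then show "norm ((\<Sum>(x, K)\<in>p. measure lborel K *\<^sub>R h x) - (g b - g a)) < e"
        unfolding T using good bad by linarith
    qed
  qed
  then have "(h has_integral (g b - g a)) {a..b}" by simp
  then show ?thesis
    by (rule has_integral_spike[OF N, rotated]) (simp add: h_def)
qed

text \<open>
  A Henstock-Kurzweil integral need not converge absolutely. If it does not, the right-hand side is
  \<open>\<infinity>\<close>; otherwise the integral is a Lebesgue integral and the usual bound applies.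
\<close>

lemma has_integral_norm_le_nn_integral:
  fixes g :: "real \<Rightarrow> real"
  assumes g: "(g has_integral I) S" and S: "S \<in> sets lebesgue"
  shows "ennreal \<bar>I\<bar> \<le> (\<integral>\<^sup>+x\<in>S. ennreal \<bar>g x\<bar> \<partial>lebesgue)"
proof (cases "(\<integral>\<^sup>+x\<in>S. ennreal \<bar>g x\<bar> \<partial>lebesgue) = \<infinity>")
  case False
  have eq: "(\<integral>\<^sup>+x\<in>S. ennreal \<bar>g x\<bar> \<partial>lebesgue) = (\<integral>\<^sup>+x. ennreal (norm (indicator S x *\<^sub>R g x)) \<partial>lebesgue)"
    by (rule nn_integral_cong) (auto simp: indicator_def)
  have "g \<in> borel_measurable (lebesgue_on S)"
    using has_integral_implies_lebesgue_measurable[OF g] S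
    by (simp add: borel_measurable_restrict_space_iff sets.Int_space_eq2)
  then have "(\<lambda>x. indicator S x *\<^sub>R g x) \<in> borel_measurable lebesgue"
    using S by (simp add: borel_measurable_restrict_space_iff)
  with False have int: "integrable lebesgue (\<lambda>x. indicator S x *\<^sub>R g x)"
    by (intro integrableI_bounded) (auto simp: eq top.not_eq_extremum)
  then have "set_integrable lebesgue S g" by (simp add: set_integrable_def)
  then have "I = (\<integral>x. indicator S x *\<^sub>R g x \<partial>lebesgue)"
    using g by (metis set_lebesgue_integral_eq_integral(2) integral_unique set_lebesgue_integral_def)
  then have "\<bar>I\<bar> \<le> (\<integral>x. norm (indicator S x *\<^sub>R g x) \<partial>lebesgue)"
    using integral_norm_bound[of lebesgue "\<lambda>x. indicator S x *\<^sub>R g x"] by (simp only: real_norm_def)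
  then show ?thesis
    using int unfolding eq by (subst nn_integral_eq_integral) (auto intro: ennreal_leI)
qed simp

section \<open>The first coordinate is 1-Lipschitz\<close>

lemma abs_continuous_fst:
  assumes "absolutely_continuous_curve k a b \<gamma>"
  shows "abs_continuous a b (\<lambda>s. fst (\<gamma> s))"
proof -
  have le: "norm (fst (\<gamma> d) - fst (\<gamma> c)) \<le> jet_euclid_dist k (\<gamma> c) (\<gamma> d)" for c d
    unfolding jet_euclid_dist_def
    by (intro real_le_rsqrt) (simp add: power2_commute sum_nonneg)
  have "(\<Sum>(c, d)\<in>D. norm (fst (\<gamma> d) - fst (\<gamma> c))) \<le> (\<Sum>(c, d)\<in>D. jet_euclid_dist k (\<gamma> c) (\<gamma> d))" for D
    using le by (auto intro!: sum_mono)
  then show ?thesis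
    using assms unfolding abs_continuous_def absolutely_continuous_curve_def by (meson order_le_less_trans)
qed

lemma fst_le_curve_length:
  assumes "a \<le> b" "horizontal_curve k a b \<gamma>"
  shows "ennreal \<bar>fst (\<gamma> b) - fst (\<gamma> a)\<bar> \<le> curve_length k a b \<gamma>"
proof -
  let ?P = "\<lambda>s. s \<in> {a<..<b} \<longrightarrow> (\<exists>v\<in>horizontal_space k (\<gamma> s). jet_has_derivative \<gamma> v s)"
  have "AE s in lebesgue. ?P s"
    using assms(2) by (simp add: horizontal_curve_def)
  then obtain N where N: "{s. \<not> ?P s} \<subseteq> N" "N \<in> null_sets lebesgue"
    unfolding eventually_ae_filter by auto
  have "negligible (N \<union> {a, b})"
    using N(2) by (auto simp: negligible_iff_null_sets[symmetric])
  moreover have "((\<lambda>s. fst (\<gamma> s)) has_vector_derivative fst (jet_deriv \<gamma> s)) (at s within {a..b})"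
    if "s \<in> {a..b} - (N \<union> {a, b})" for s
  proof -
    have "s \<in> {a<..<b}" using that by auto
    moreover have "?P s" using that N(1) by blast
    ultimately obtain v where "((\<lambda>r. fst (\<gamma> r)) has_real_derivative v) (at s)"
      by (auto simp: jet_has_derivative_def)
    then show ?thesis
      by (metis DERIV_imp_deriv DERIV_subset fst_conv has_real_derivative_iff_has_vector_derivative
          jet_deriv_def subset_UNIV)
  qed
  ultimately have "((\<lambda>s. fst (jet_deriv \<gamma> s)) has_integral (fst (\<gamma> b) - fst (\<gamma> a))) {a..b}"
    using assms
    by (intro abs_continuous_has_integral[of _ _ _ "N \<union> {a, b}"] abs_continuous_fst[of k])
      (auto simp: horizontal_curve_def)
  then have "ennreal \<bar>fst (\<gamma> b) - fst (\<gamma> a)\<bar> \<le> (\<integral>\<^sup>+s\<in>{a..b}. ennreal \<bar>fst (jet_deriv \<gamma> s)\<bar> \<partial>lebesgue)"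
    by (rule has_integral_norm_le_nn_integral) simp
  also have "\<dots> \<le> curve_length k a b \<gamma>"
    unfolding curve_length_def
    by (intro nn_integral_mono mult_right_mono ennreal_leI)
      (auto simp: horizontal_norm_def intro!: real_le_rsqrt)
  finally show ?thesis .
qed

lemma fst_le_cc_dist: "ennreal \<bar>fst p - fst q\<bar> \<le> cc_dist k p q"
  unfolding cc_dist_def
  by (intro Inf_greatest) (use fst_le_curve_length in \<open>force simp: abs_minus_commute\<close>)

section \<open>Arcs in the image of a jet\<close>

lemma smooth_has_derivative:
  assumes "smooth f"
  shows "((deriv ^^ n) f has_real_derivative (deriv ^^ Suc n) f x) (at x)"
  using assms unfolding smooth_def
  by (auto simp: differentiable_on_def DERIV_deriv_iff_real_differentiable)

lemma smooth_bounded_derivative: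
  assumes "smooth f"
  obtains B where "\<And>x. x \<in> {a..b} \<Longrightarrow> \<bar>(deriv ^^ n) f x\<bar> \<le> B"
proof -
  have "continuous_on {a..b} ((deriv ^^ n) f)"
    using smooth_has_derivative[OF assms] by (meson DERIV_isCont continuous_at_imp_continuous_on)
  then have "bounded ((deriv ^^ n) f ` {a..b})"
    by (intro compact_imp_bounded compact_continuous_image) auto
  then obtain B where "\<forall>x\<in>{a..b}. \<bar>(deriv ^^ n) f x\<bar> \<le> B"
    by (auto simp: bounded_iff)
  then show thesis
    using that by blast
qed

lemma smooth_derivative_lipschitz:
  assumes "smooth f"
  obtains B where "B \<ge> 0"
    "\<And>x y. \<lbrakk>x \<in> {a..b}; y \<in> {a..b}\<rbrakk> \<Longrightarrow> \<bar>(deriv ^^ n) f x - (deriv ^^ n) f y\<bar> \<le> B * \<bar>x - y\<bar>"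
proof -
  obtain B where B: "\<And>x. x \<in> {a..b} \<Longrightarrow> \<bar>(deriv ^^ Suc n) f x\<bar> \<le> B"
    using smooth_bounded_derivative[OF assms] by blast
  show thesis
  proof (rule that[of "max 0 B"])
    fix x y assume xy: "x \<in> {a..b}" "y \<in> {a..b}"
    have "norm ((deriv ^^ n) f x - (deriv ^^ n) f y) \<le> max 0 B * norm (x - y)"
    proof (rule field_differentiable_bound[of "{a..b}"])
      show "((deriv ^^ n) f has_field_derivative (deriv ^^ Suc n) f z) (at z within {a..b})" for z
        using smooth_has_derivative[OF assms] by (rule has_field_derivative_at_within)
      show "norm ((deriv ^^ Suc n) f z) \<le> max 0 B" if "z \<in> {a..b}" for z
        using B[OF that] by (simp del: funpow.simps)
    qed (use xy in auto)
    then show "\<bar>(deriv ^^ n) f x - (deriv ^^ n) f y\<bar> \<le> max 0 B * \<bar>x - y\<bar>" by simp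
  qed simp
qed

lemma jet_euclid_dist_le_sum:
  "jet_euclid_dist k p q \<le> \<bar>fst p - fst q\<bar> + (\<Sum>j\<le>k. \<bar>snd p j - snd q j\<bar>)"
proof -
  have "jet_euclid_dist k p q \<le> \<bar>fst p - fst q\<bar> + sqrt (\<Sum>j\<le>k. (snd p j - snd q j)\<^sup>2)"
    unfolding jet_euclid_dist_def
    using sqrt_add_le_add_sqrt[of "(fst p - fst q)\<^sup>2" "\<Sum>j\<le>k. (snd p j - snd q j)\<^sup>2"]
    by (simp add: sum_nonneg)
  also have "sqrt (\<Sum>j\<le>k. (snd p j - snd q j)\<^sup>2) \<le> (\<Sum>j\<le>k. \<bar>snd p j - snd q j\<bar>)"
    using L2_set_le_sum_abs[of "\<lambda>j. snd p j - snd q j" "{..k}"] by (simp add: L2_set_def)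
  finally show ?thesis by simp
qed

lemma lipschitz_imp_absolutely_continuous_curve:
  assumes "\<And>c d. \<lbrakk>a \<le> c; c \<le> d; d \<le> b\<rbrakk> \<Longrightarrow> jet_euclid_dist k (\<gamma> c) (\<gamma> d) \<le> L * (d - c)"
  shows "absolutely_continuous_curve k a b \<gamma>"
  unfolding absolutely_continuous_curve_def
proof (intro allI impI)
  fix \<epsilon> :: real assume "\<epsilon> > 0"
  define L' where "L' = \<bar>L\<bar> + 1"
  have "L' > 0" by (simp add: L'_def)
  show "\<exists>\<delta>>0. \<forall>D. finite D \<and> (\<forall>(c, d)\<in>D. a \<le> c \<and> c \<le> d \<and> d \<le> b) \<and>
      disjoint_family_on (\<lambda>(c, d). {c<..<d}) D \<and> (\<Sum>(c, d)\<in>D. d - c) < \<delta>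
      \<longrightarrow> (\<Sum>(c, d)\<in>D. jet_euclid_dist k (\<gamma> c) (\<gamma> d)) < \<epsilon>"
  proof (intro exI[of _ "\<epsilon> / L'"] conjI allI impI; (elim conjE)?)
    show "\<epsilon> / L' > 0" using \<open>\<epsilon> > 0\<close> \<open>L' > 0\<close> by simp
    fix D :: "(real \<times> real) set"
    assume D: "\<forall>(c, d)\<in>D. a \<le> c \<and> c \<le> d \<and> d \<le> b" and small: "(\<Sum>(c, d)\<in>D. d - c) < \<epsilon> / L'"
    have "(\<Sum>(c, d)\<in>D. jet_euclid_dist k (\<gamma> c) (\<gamma> d)) \<le> (\<Sum>(c, d)\<in>D. L' * (d - c))"
    proof (rule sum_mono, clarify)
      fix c d assume "(c, d) \<in> D"
      then have cd: "a \<le> c" "c \<le> d" "d \<le> b" using D by auto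
      have "L * (d - c) \<le> L' * (d - c)"
        using cd by (intro mult_right_mono) (auto simp: L'_def)
      with assms[OF cd] show "jet_euclid_dist k (\<gamma> c) (\<gamma> d) \<le> L' * (d - c)" by linarith
    qed
    also have "\<dots> = L' * (\<Sum>(c, d)\<in>D. d - c)"
      by (simp add: sum_distrib_left case_prod_unfold)
    also have "\<dots> < \<epsilon>"
      using small \<open>L' > 0\<close> by (simp add: field_simps)
    finally show "(\<Sum>(c, d)\<in>D. jet_euclid_dist k (\<gamma> c) (\<gamma> d)) < \<epsilon>" .
  qed
qed

text \<open>
  The factor \<open>\<sigma>\<close> is meant to be \<open>1\<close> or \<open>-1\<close>: a curve runs over an interval \<open>[a, b]\<close> with \<open>a \<le> b\<close>, so
  joining \<open>j\<^sup>k\<^sub>u(f)\<close> to \<open>j\<^sup>k\<^sub>v(f)\<close> with \<open>u > v\<close> requires the reversed parametrisation.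
  The components below \<open>u\<^sub>k\<close> satisfy the horizontality condition because each coordinate
  of a jet is the derivative of the next one.
\<close>

lemma jet_has_derivative_jet:
  assumes "smooth f"
  shows "jet_has_derivative (\<lambda>s. jet k f (\<sigma> * s))
    (jet_lincomb \<sigma> (field_X k (jet k f (\<sigma> * s)))
      (\<sigma> * (deriv ^^ Suc k) f (\<sigma> * s)) (field_U k (jet k f (\<sigma> * s)))) s"
    (is "jet_has_derivative _ ?v s")
proof -
  have *: "((\<lambda>s. (deriv ^^ j) f (\<sigma> * s)) has_real_derivative \<sigma> * (deriv ^^ Suc j) f (\<sigma> * s)) (at s)" for j
    using DERIV_chain2[OF smooth_has_derivative[OF assms] DERIV_cmult_Id, of j \<sigma> s UNIV]
    by (simp add: mult.commute[of _ \<sigma>])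
  note defs = jet_def jet_lincomb_def field_X_def field_U_def
  have "((\<lambda>r. snd (jet k f (\<sigma> * r)) j) has_real_derivative snd ?v j) (at s)" for j
  proof (cases j k rule: linorder_cases)
    case less then show ?thesis using *[of j] by (simp add: defs)
  next
    case equal then show ?thesis using *[of k] by (simp add: defs)
  next
    case greater then show ?thesis by (simp add: defs)
  qed
  moreover have "((\<lambda>r. fst (jet k f (\<sigma> * r))) has_real_derivative fst ?v) (at s)"
    by (auto simp: defs intro!: derivative_eq_intros)
  ultimately show ?thesis
    unfolding jet_has_derivative_def by blast
qed

lemma jet_deriv_eq:
  "jet_has_derivative \<gamma> v s \<Longrightarrow> jet_deriv \<gamma> s = v"
  unfolding jet_has_derivative_def jet_deriv_def by (auto simp: prod_eq_iff DERIV_imp_deriv)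

text \<open>
  The velocity has been computed above; absolute continuity holds because every derivative of a
  smooth function is Lipschitz on the compact interval swept out by \<open>\<sigma> * s\<close>.
\<close>

lemma horizontal_curve_jet:
  assumes "smooth f" and "\<bar>\<sigma>\<bar> = 1"
  shows "horizontal_curve k a b (\<lambda>s. jet k f (\<sigma> * s))"
proof -
  define R where "R = max \<bar>a\<bar> \<bar>b\<bar>"
  have R: "\<sigma> * s \<in> {-R..R}" if "a \<le> s" "s \<le> b" for s
  proof -
    have "\<bar>\<sigma> * s\<bar> \<le> R" using that assms(2) by (auto simp: abs_mult R_def)
    then show ?thesis by auto
  qed
  have "\<exists>B. \<forall>x\<in>{-R..R}. \<forall>y\<in>{-R..R}. \<bar>(deriv ^^ n) f x - (deriv ^^ n) f y\<bar> \<le> B * \<bar>x - y\<bar>" for n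
    using smooth_derivative_lipschitz[OF assms(1)] by metis
  then obtain B where B: "\<And>n x y. \<lbrakk>x \<in> {-R..R}; y \<in> {-R..R}\<rbrakk>
      \<Longrightarrow> \<bar>(deriv ^^ n) f x - (deriv ^^ n) f y\<bar> \<le> B n * \<bar>x - y\<bar>"
    by metis
  have "absolutely_continuous_curve k a b (\<lambda>s. jet k f (\<sigma> * s))"
  proof (rule lipschitz_imp_absolutely_continuous_curve)
    fix c d assume cd: "a \<le> c" "c \<le> d" "d \<le> b"
    have dist: "\<bar>\<sigma> * c - \<sigma> * d\<bar> = d - c"
      using cd assms(2) by (simp flip: right_diff_distrib add: abs_mult)
    have "jet_euclid_dist k (jet k f (\<sigma> * c)) (jet k f (\<sigma> * d))
        \<le> (d - c) + (\<Sum>j\<le>k. \<bar>(deriv ^^ j) f (\<sigma> * c) - (deriv ^^ j) f (\<sigma> * d)\<bar>)"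
      using jet_euclid_dist_le_sum[of k "jet k f (\<sigma> * c)" "jet k f (\<sigma> * d)"] dist
      by (simp add: jet_def)
    also have "\<dots> \<le> (d - c) + (\<Sum>j\<le>k. B j * (d - c))"
      using B[OF R R, of c d] cd dist by (intro add_left_mono sum_mono) simp
    also have "\<dots> = (1 + (\<Sum>j\<le>k. B j)) * (d - c)"
      by (simp add: algebra_simps sum_distrib_left sum_distrib_right sum_subtractf)
    finally show "jet_euclid_dist k (jet k f (\<sigma> * c)) (jet k f (\<sigma> * d)) \<le> \<dots>" .
  qed
  moreover have "\<exists>v\<in>horizontal_space k (jet k f (\<sigma> * s)). jet_has_derivative (\<lambda>s. jet k f (\<sigma> * s)) v s" for s
    using jet_has_derivative_jet[OF assms(1)] by (fastforce simp: horizontal_space_def)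
  ultimately show ?thesis
    by (auto simp: horizontal_curve_def jet_space_def jet_def)
qed

lemma curve_length_jet_le:
  assumes "smooth f" and "\<bar>\<sigma>\<bar> = 1" and "a \<le> b"
    and B: "\<And>s. s \<in> {a..b} \<Longrightarrow> \<bar>(deriv ^^ Suc k) f (\<sigma> * s)\<bar> \<le> B"
  shows "curve_length k a b (\<lambda>s. jet k f (\<sigma> * s)) \<le> ennreal (sqrt (1 + B\<^sup>2) * (b - a))"
proof -
  have \<sigma>: "\<sigma>\<^sup>2 = 1" using assms(2) by (metis power2_abs one_power2)
  have "horizontal_norm k (jet_deriv (\<lambda>s. jet k f (\<sigma> * s)) s) \<le> sqrt (1 + B\<^sup>2)" if "s \<in> {a..b}" for s
  proof -
    have "((deriv ^^ Suc k) f (\<sigma> * s))\<^sup>2 \<le> B\<^sup>2"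
      using B[OF that] by (simp only: abs_le_square_iff[symmetric])
    then show ?thesis
      unfolding jet_deriv_eq[OF jet_has_derivative_jet[OF assms(1)]] horizontal_norm_frame
      by (simp add: power_mult_distrib \<sigma> del: funpow.simps)
  qed
  then have "curve_length k a b (\<lambda>s. jet k f (\<sigma> * s))
      \<le> (\<integral>\<^sup>+s. ennreal (sqrt (1 + B\<^sup>2)) * indicator {a..b} s \<partial>lebesgue)"
    unfolding curve_length_def
    by (intro nn_integral_mono) (auto simp: indicator_def intro!: ennreal_leI)
  also have "\<dots> = ennreal (sqrt (1 + B\<^sup>2)) * emeasure lebesgue {a..b}"
    by (rule nn_integral_cmult_indicator) simp
  also have "\<dots> = ennreal (sqrt (1 + B\<^sup>2) * (b - a))"
    using \<open>a \<le> b\<close> by (simp add: ennreal_mult)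
  finally show ?thesis .
qed

lemma cc_dist_jet_le:
  assumes "smooth f" and B: "\<And>x. x \<in> closed_segment u v \<Longrightarrow> \<bar>(deriv ^^ Suc k) f x\<bar> \<le> B"
  shows "cc_dist k (jet k f u) (jet k f v) \<le> ennreal (sqrt (1 + B\<^sup>2) * \<bar>u - v\<bar>)"
proof -
  define \<sigma> :: real where "\<sigma> = (if u \<le> v then 1 else -1)"
  have \<sigma>: "\<bar>\<sigma>\<bar> = 1" "\<sigma> * (\<sigma> * u) = u" "\<sigma> * (\<sigma> * v) = v" "\<sigma> * u \<le> \<sigma> * v"
    and len: "\<sigma> * v - \<sigma> * u = \<bar>u - v\<bar>"
    by (auto simp: \<sigma>_def)
  have seg: "\<sigma> * s \<in> closed_segment u v" if "s \<in> {\<sigma> * u..\<sigma> * v}" for s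
    using that by (auto simp: \<sigma>_def closed_segment_eq_real_ivl split: if_splits)
  let ?\<gamma> = "\<lambda>s. jet k f (\<sigma> * s)"
  have "cc_dist k (jet k f u) (jet k f v) \<le> curve_length k (\<sigma> * u) (\<sigma> * v) ?\<gamma>"
    unfolding cc_dist_def
    by (rule Inf_lower, rule CollectI, intro exI[of _ "\<sigma> * u"] exI[of _ "\<sigma> * v"] exI[of _ ?\<gamma>])
      (simp add: horizontal_curve_jet[OF assms(1) \<sigma>(1)] \<sigma>)
  also have "\<dots> \<le> ennreal (sqrt (1 + B\<^sup>2) * (\<sigma> * v - \<sigma> * u))"
    using B seg by (intro curve_length_jet_le assms(1) \<sigma>) blast
  finally show ?thesis by (simp only: len)
qed

section \<open>Local Lipschitz continuity of horizontal mappings\<close>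

theorem proposition3p6:
  fixes k :: nat and t :: real and f :: "real \<Rightarrow> real"
  assumes "k \<ge> 1" and "smooth f"
  shows "cc_locally_lipschitz k (jet_space k) (jet_image k f) (horizontal_map k f t)"
  unfolding cc_locally_lipschitz_def
proof (intro conjI allI impI)
  show "horizontal_map k f t \<in> jet_space k \<rightarrow> jet_image k f"
    by (auto simp: horizontal_map_def jet_image_def)
next
  fix K assume "compact K \<and> K \<subseteq> jet_space k"
  then have "bounded (fst ` K)"
    by (intro compact_imp_bounded compact_continuous_image continuous_intros) auto
  then obtain R where R: "\<And>p. p \<in> K \<Longrightarrow> \<bar>fst p\<bar> \<le> R"
    by (auto simp: bounded_iff)
  obtain B where B: "\<And>x. x \<in> {-R - t..R - t} \<Longrightarrow> \<bar>(deriv ^^ Suc k) f x\<bar> \<le> B"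
    using smooth_bounded_derivative[OF assms(2)] by blast
  define M where "M = sqrt (1 + B\<^sup>2)"
  have "M \<ge> 0" by (simp add: M_def)
  have "cc_dist k (horizontal_map k f t p) (horizontal_map k f t q) \<le> ennreal M * cc_dist k p q"
    if "p \<in> K" "q \<in> K" for p q
  proof -
    have "closed_segment (fst p - t) (fst q - t) \<subseteq> {-R - t..R - t}"
      using R[OF that(1)] R[OF that(2)] by (auto simp: closed_segment_eq_real_ivl split: if_splits)
    then have "cc_dist k (horizontal_map k f t p) (horizontal_map k f t q)
        \<le> ennreal (M * \<bar>(fst p - t) - (fst q - t)\<bar>)"
      unfolding horizontal_map_def M_def using B by (intro cc_dist_jet_le assms(2)) blast
    also have "\<dots> = ennreal M * ennreal \<bar>fst p - fst q\<bar>"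
      using \<open>M \<ge> 0\<close> by (simp add: ennreal_mult)
    also have "\<dots> \<le> ennreal M * cc_dist k p q"
      by (intro mult_left_mono fst_le_cc_dist) simp
    finally show ?thesis .
  qed
  with \<open>M \<ge> 0\<close> show "cc_lipschitz_on k K (horizontal_map k f t)"
    unfolding cc_lipschitz_on_def by blast
qed

end
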